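(* There is an algorithm that, given a matching market with single-peaked preferences (with preference relations computable in constant time) and a perfect matching $\mu$, decides whether $\mu$ is stable in $O(n\log n)$ time.
   Context: A matching market has $n$ men and $n$ women. The men's preferences are single-peaked if the women are placed at points on a line, $p(w_1)<p(w_2)<\dots<p(w_n)$, and each man $m$ has a point $q(m)$ and a preference relation $\succ_m$ on the women such that whenever $p(w_i)\le q(m)$ we have $w_i\succ_m w_j$ for all $j<i$, and whenever $p(w_i)\ge q(m)$ we have $w_i\succ_m w_j$ for all $j>i$. The women's preferences are single-peaked analogously (men at points $p(m_1)<\dots<p(m_n)$, each woman with a point $q(w)$ and relation $\succ_w$), and the market has single-peaked preferences if both sides do. It is assumed that each comparison under a preference relation takes constant time. A perfect matching $\mu$ is stable if there is no pair $(m,w)\notin\mu$ with $w\succ_m\mu(m)$ and $m\succ_w\mu(w)$. *)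

theory Defs
  imports Complex_Main "HOL-Library.Landau_Symbols"
begin

section \<open>Matching markets with single-peaked preferences\<close>

text \<open>
  The men and the women are both numbered \<open>0, \<dots>, n - 1\<close>.  \<open>men_pref M m w w'\<close> says that man \<open>m\<close>
  strictly prefers woman \<open>w\<close> to woman \<open>w'\<close>; \<open>women_pref M w m m'\<close> says that woman \<open>w\<close> strictly
  prefers man \<open>m\<close> to man \<open>m'\<close>.  Values at arguments outside the range are unconstrained.
\<close>

record market =
  num :: nat
  men_pref :: "nat \<Rightarrow> nat \<Rightarrow> nat \<Rightarrow> bool"
  women_pref :: "nat \<Rightarrow> nat \<Rightarrow> nat \<Rightarrow> bool"

definition strict_ranking :: "nat \<Rightarrow> (nat \<Rightarrow> nat \<Rightarrow> bool) \<Rightarrow> bool" where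
  "strict_ranking n R \<longleftrightarrow>
     irreflp_on {..<n} R \<and> transp_on {..<n} R \<and> totalp_on {..<n} R"

definition matching_market :: "market \<Rightarrow> bool" where
  "matching_market M \<longleftrightarrow>
     (\<forall>m<num M. strict_ranking (num M) (men_pref M m)) \<and>
     (\<forall>w<num M. strict_ranking (num M) (women_pref M w))"

text \<open>
  \<open>p i\<close> is the point of the \<open>i\<close>-th agent being ranked and \<open>q a\<close> is the point of the ranking agent
  \<open>a\<close>.  The agents being ranked are numbered in the order in which they lie on the line.
\<close>

definition single_peaked :: "nat \<Rightarrow> (nat \<Rightarrow> nat \<Rightarrow> nat \<Rightarrow> bool) \<Rightarrow> bool" where
  "single_peaked n pref \<longleftrightarrow>
     (\<exists>(p :: nat \<Rightarrow> real) (q :: nat \<Rightarrow> real).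
        strict_mono_on {..<n} p \<and>
        (\<forall>a<n. \<forall>i<n.
           (p i \<le> q a \<longrightarrow> (\<forall>j<i. pref a i j)) \<and>
           (p i \<ge> q a \<longrightarrow> (\<forall>j. i < j \<and> j < n \<longrightarrow> pref a i j))))"

definition single_peaked_market :: "market \<Rightarrow> bool" where
  "single_peaked_market M \<longleftrightarrow>
     matching_market M \<and>
     single_peaked (num M) (men_pref M) \<and>
     single_peaked (num M) (women_pref M)"

text \<open>A perfect matching is given as the map sending each man to his partner.\<close>

definition perfect_matching :: "market \<Rightarrow> (nat \<Rightarrow> nat) \<Rightarrow> bool" where
  "perfect_matching M \<mu> \<longleftrightarrow> bij_betw \<mu> {..<num M} {..<num M}"

definition husband :: "market \<Rightarrow> (nat \<Rightarrow> nat) \<Rightarrow> nat \<Rightarrow> nat" where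
  "husband M \<mu> w = the_inv_into {..<num M} \<mu> w"

definition stable_matching :: "market \<Rightarrow> (nat \<Rightarrow> nat) \<Rightarrow> bool" where
  "stable_matching M \<mu> \<longleftrightarrow>
     \<not> (\<exists>m<num M. \<exists>w<num M. \<mu> m \<noteq> w \<and>
          men_pref M m w (\<mu> m) \<and> women_pref M w m (husband M \<mu> w))"


section \<open>A word RAM with preference queries\<close>

text \<open>
  Algorithms are programs of an imperative language with finitely many word variables and arrays.
  The preferences can be accessed only through the two comparison queries \<open>MenPref\<close> and
  \<open>WomenPref\<close>; in particular, a program has no access to the points on the line.
\<close>

datatype aexp =
    N nat
  | V string
  | Get string aexp
  | Add aexp aexp
  | Sub aexp aexp
  | Mul aexp aexp
  | Quot aexp aexp

datatype bexp =
    Less aexp aexp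
  | Neg bexp
  | Conj bexp bexp
  | MenPref aexp aexp aexp
  | WomenPref aexp aexp aexp

datatype com =
    Skip
  | Assign string aexp
  | Put string aexp aexp
  | Seq com com
  | If bexp com com
  | While bexp com

record state =
  vars :: "string \<Rightarrow> nat"
  arrs :: "string \<Rightarrow> nat \<Rightarrow> nat"

primrec aval :: "state \<Rightarrow> aexp \<Rightarrow> nat" where
  "aval s (N k) = k"
| "aval s (V x) = vars s x"
| "aval s (Get a e) = arrs s a (aval s e)"
| "aval s (Add e f) = aval s e + aval s f"
| "aval s (Sub e f) = aval s e - aval s f"
| "aval s (Mul e f) = aval s e * aval s f"
| "aval s (Quot e f) = aval s e div aval s f"

primrec bval :: "market \<Rightarrow> state \<Rightarrow> bexp \<Rightarrow> bool" where
  "bval M s (Less e f) \<longleftrightarrow> aval s e < aval s f"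
| "bval M s (Neg b) \<longleftrightarrow> \<not> bval M s b"
| "bval M s (Conj b c) \<longleftrightarrow> bval M s b \<and> bval M s c"
| "bval M s (MenPref e f g) \<longleftrightarrow> men_pref M (aval s e) (aval s f) (aval s g)"
| "bval M s (WomenPref e f g) \<longleftrightarrow> women_pref M (aval s e) (aval s f) (aval s g)"

text \<open>
  Every operation, array access and query takes unit time.  To keep this cost measure realistic,
  every number occurring in the evaluation of an expression must be smaller than the bound \<open>B\<close>
  (\<open>2 ^ w\<close> for \<open>w\<close>-bit words); a program that exceeds the bound has no execution.
\<close>

primrec afits :: "nat \<Rightarrow> state \<Rightarrow> aexp \<Rightarrow> bool" where
  "afits B s (N k) \<longleftrightarrow> k < B"
| "afits B s (V x) \<longleftrightarrow> vars s x < B"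
| "afits B s (Get a e) \<longleftrightarrow> afits B s e \<and> aval s (Get a e) < B"
| "afits B s (Add e f) \<longleftrightarrow> afits B s e \<and> afits B s f \<and> aval s (Add e f) < B"
| "afits B s (Sub e f) \<longleftrightarrow> afits B s e \<and> afits B s f \<and> aval s (Sub e f) < B"
| "afits B s (Mul e f) \<longleftrightarrow> afits B s e \<and> afits B s f \<and> aval s (Mul e f) < B"
| "afits B s (Quot e f) \<longleftrightarrow> afits B s e \<and> afits B s f \<and> aval s (Quot e f) < B"

primrec bfits :: "nat \<Rightarrow> state \<Rightarrow> bexp \<Rightarrow> bool" where
  "bfits B s (Less e f) \<longleftrightarrow> afits B s e \<and> afits B s f"
| "bfits B s (Neg b) \<longleftrightarrow> bfits B s b"
| "bfits B s (Conj b c) \<longleftrightarrow> bfits B s b \<and> bfits B s c"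
| "bfits B s (MenPref e f g) \<longleftrightarrow> afits B s e \<and> afits B s f \<and> afits B s g"
| "bfits B s (WomenPref e f g) \<longleftrightarrow> afits B s e \<and> afits B s f \<and> afits B s g"

primrec acost :: "aexp \<Rightarrow> nat" where
  "acost (N k) = 1"
| "acost (V x) = 1"
| "acost (Get a e) = 1 + acost e"
| "acost (Add e f) = 1 + acost e + acost f"
| "acost (Sub e f) = 1 + acost e + acost f"
| "acost (Mul e f) = 1 + acost e + acost f"
| "acost (Quot e f) = 1 + acost e + acost f"

primrec bcost :: "bexp \<Rightarrow> nat" where
  "bcost (Less e f) = 1 + acost e + acost f"
| "bcost (Neg b) = 1 + bcost b"
| "bcost (Conj b c) = 1 + bcost b + bcost c"
| "bcost (MenPref e f g) = 1 + acost e + acost f + acost g"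
| "bcost (WomenPref e f g) = 1 + acost e + acost f + acost g"

text \<open>
  \<open>exec M B c s t s'\<close>: on the market \<open>M\<close> and with word bound \<open>B\<close>, the program \<open>c\<close> started in
  state \<open>s\<close> terminates after exactly \<open>t\<close> time steps in state \<open>s'\<close>.
\<close>

inductive exec :: "market \<Rightarrow> nat \<Rightarrow> com \<Rightarrow> state \<Rightarrow> nat \<Rightarrow> state \<Rightarrow> bool"
  for M :: market and B :: nat where
  Skip: "exec M B Skip s 1 s"
| Assign: "afits B s e \<Longrightarrow>
    exec M B (Assign x e) s (1 + acost e) (s\<lparr>vars := (vars s)(x := aval s e)\<rparr>)"
| Put: "afits B s e \<Longrightarrow> afits B s f \<Longrightarrow>
    exec M B (Put a e f) s (1 + acost e + acost f)
      (s\<lparr>arrs := (arrs s)(a := (arrs s a)(aval s e := aval s f))\<rparr>)"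
| Seq: "exec M B c s t s' \<Longrightarrow> exec M B d s' u s'' \<Longrightarrow>
    exec M B (Seq c d) s (t + u) s''"
| IfTrue: "bfits B s b \<Longrightarrow> bval M s b \<Longrightarrow> exec M B c s t s' \<Longrightarrow>
    exec M B (If b c d) s (1 + bcost b + t) s'"
| IfFalse: "bfits B s b \<Longrightarrow> \<not> bval M s b \<Longrightarrow> exec M B d s t s' \<Longrightarrow>
    exec M B (If b c d) s (1 + bcost b + t) s'"
| WhileFalse: "bfits B s b \<Longrightarrow> \<not> bval M s b \<Longrightarrow>
    exec M B (While b c) s (1 + bcost b) s"
| WhileTrue: "bfits B s b \<Longrightarrow> bval M s b \<Longrightarrow> exec M B c s t s' \<Longrightarrow>
    exec M B (While b c) s' u s'' \<Longrightarrow>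
    exec M B (While b c) s (1 + bcost b + t + u) s''"

lemma exec_deterministic:
  assumes "exec M B c s t s'" and "exec M B c s u s''"
  shows "u = t \<and> s'' = s'"
  using assms
proof (induction arbitrary: u s'' rule: exec.induct)
  case Skip
  then show ?case by (auto elim: exec.cases)
next
  case Assign
  from Assign.prems show ?case by cases auto
next
  case Put
  from Put.prems show ?case by cases auto
next
  case Seq
  from Seq.prems show ?case by cases (use Seq.IH in blast)
next
  case IfTrue
  from IfTrue.prems show ?case by cases (use IfTrue in blast)+
next
  case IfFalse
  from IfFalse.prems show ?case by cases (use IfFalse in blast)+
next
  case WhileFalse
  from WhileFalse.prems show ?case by cases (use WhileFalse in auto)
next
  case WhileTrue
  from WhileTrue.prems show ?case by cases (use WhileTrue in blast)+
qed

text \<open>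
  The number of agents per side is passed in the variable \<open>n\<close> and the matching in the array \<open>mu\<close>.
\<close>

definition input_state :: "market \<Rightarrow> (nat \<Rightarrow> nat) \<Rightarrow> state" where
  "input_state M \<mu> =
     \<lparr>vars = (\<lambda>_. 0)(''n'' := num M),
      arrs = (\<lambda>_ _. 0)(''mu'' := (\<lambda>i. if i < num M then \<mu> i else 0))\<rparr>"

end

theory Submission
  imports Defs
begin

text \<open>
  By single-peakedness, the partners that an agent weakly prefers to the assigned one form an
  interval, whose ends are found by binary search because the agents are numbered along the line.
  A blocking pair \<open>(m, w)\<close> is therefore a crossing of \<open>m\<close>'s interval and \<open>w\<close>'s interval in the
  grid of men and women. A sweep over the men detects the crossings with wives of earlier men:
  the wife of each processed man is entered into a tree of range maxima with the upper end of her
  interval, and the current man asks whether the maximum over his interval exceeds his own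
  position. A second sweep in the reverse order handles the wives of later men.
\<close>

subsection \<open>Timed total correctness\<close>

text \<open>A crossing imposes conditions at both ends of both intervals, yet one number per wife
  suffices. Her interval contains her husband, who in a sweep stands before the current man, so the
  current man lies in it iff his position is below its exclusive upper end. The women he prefers
  form an index range apart from his own wife, hence one range maximum decides whether any wife of
  an earlier man blocks with him. His own wife lies in the range too; she enters the tree only after
  his query and cannot raise a false alarm.

  The program sees comparisons but no points. All that single-peakedness contributes is betweenness:
  an agent strictly between the partner and a preferred agent is preferred as well.

  Each man costs three binary searches, one query and one insertion, all of them loops of at most
  \<open>lev n\<close> rounds. The largest numbers that occur are the cell indices
  \<open>k * n + j\<close> of the tree, which stay below \<open>(n + 2)^2\<close> because
  \<open>k < lev n \<le> n\<close>; so words of about twice the bit length of \<open>n\<close> are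
  enough.\<close>

definition runs :: "market \<Rightarrow> nat \<Rightarrow> com \<Rightarrow> state \<Rightarrow> nat \<Rightarrow> (state \<Rightarrow> bool) \<Rightarrow> bool" where
  "runs M B c s T Q \<longleftrightarrow> (\<exists>t s'. exec M B c s t s' \<and> t \<le> T \<and> Q s')"

lemma runs_Seq:
  assumes "runs M B c s T P" and "\<And>s'. P s' \<Longrightarrow> runs M B d s' U Q"
  shows "runs M B (Seq c d) s (T + U) Q"
proof -
  from assms(1) obtain t s' where 1: "exec M B c s t s'" "t \<le> T" "P s'"
    unfolding runs_def by blast
  from assms(2)[OF 1(3)] obtain u s'' where "exec M B d s' u s''" "u \<le> U" "Q s''"
    unfolding runs_def by blast
  with 1 show ?thesis
    unfolding runs_def by (meson exec.Seq add_mono)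
qed

lemma runs_weaken:
  assumes "runs M B c s T P" and "\<And>s'. P s' \<Longrightarrow> Q s'" and "T \<le> U"
  shows "runs M B c s U Q"
  using assms unfolding runs_def by (meson order_trans)

text \<open>The invariant carries the number \<open>k\<close> of completed rounds. Since it forces
  \<open>k < K\<close> whenever the guard holds, \<open>K - k\<close> is a termination measure and
  \<open>K\<close> bounds the rounds, so termination and running time come from the same
  induction.\<close>

lemma runs_While:
  assumes "I 0 s"
    and fits: "\<And>k s. I k s \<Longrightarrow> bfits B s b"
    and step: "\<And>k s. I k s \<Longrightarrow> bval M s b \<Longrightarrow> k < K \<and> runs M B c s T (I (Suc k))"
    and exit: "\<And>k s. I k s \<Longrightarrow> \<not> bval M s b \<Longrightarrow> Q s"
  shows "runs M B (While b c) s (K * (1 + bcost b + T) + 1 + bcost b) Q"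
proof -
  have "runs M B (While b c) s ((K - k) * (1 + bcost b + T) + 1 + bcost b) Q"
    if "I k s" for k s
    using that
  proof (induction "K - k" arbitrary: k s rule: less_induct)
    case less
    show ?case
    proof (cases "bval M s b")
      case False
      then have "exec M B (While b c) s (1 + bcost b) s"
        using fits less.prems by (blast intro: exec.WhileFalse)
      then show ?thesis
        unfolding runs_def using exit[OF less.prems False] by force
    next
      case True
      then obtain t s' where 1: "k < K" "exec M B c s t s'" "t \<le> T" "I (Suc k) s'"
        using step less.prems unfolding runs_def by blast
      then obtain u s'' where 2: "exec M B (While b c) s' u s''"
        "u \<le> (K - Suc k) * (1 + bcost b + T) + 1 + bcost b" "Q s''"
        using less.hyps[OF diff_less_mono2[OF lessI 1(1)] 1(4)] unfolding runs_def by blast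
      have "exec M B (While b c) s (1 + bcost b + t + u) s''"
        using fits less.prems True 1 2 by (blast intro: exec.WhileTrue)
      moreover have "K - k = Suc (K - Suc k)"
        using 1 by simp
      then have "1 + bcost b + t + u \<le> (K - k) * (1 + bcost b + T) + 1 + bcost b"
        using 1 2 by simp
      ultimately show ?thesis
        unfolding runs_def using 2 by blast
    qed
  qed
  from this[OF assms(1)] show ?thesis by simp
qed

text \<open>
  Loop-free programs are executed by the simplifier. The clauses for \<open>While\<close> are junk and are
  excluded by \<open>safe\<close>.
\<close>

primrec run :: "market \<Rightarrow> com \<Rightarrow> state \<Rightarrow> state" where
  "run M Skip s = s"
| "run M (Assign x e) s = s\<lparr>vars := (vars s)(x := aval s e)\<rparr>"
| "run M (Put a e f) s = s\<lparr>arrs := (arrs s)(a := (arrs s a)(aval s e := aval s f))\<rparr>"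
| "run M (Seq c d) s = run M d (run M c s)"
| "run M (If b c d) s = (if bval M s b then run M c s else run M d s)"
| "run M (While b c) s = s"

primrec safe :: "market \<Rightarrow> nat \<Rightarrow> com \<Rightarrow> state \<Rightarrow> bool" where
  "safe M B Skip s \<longleftrightarrow> True"
| "safe M B (Assign x e) s \<longleftrightarrow> afits B s e"
| "safe M B (Put a e f) s \<longleftrightarrow> afits B s e \<and> afits B s f"
| "safe M B (Seq c d) s \<longleftrightarrow> safe M B c s \<and> safe M B d (run M c s)"
| "safe M B (If b c d) s \<longleftrightarrow>
     bfits B s b \<and> (if bval M s b then safe M B c s else safe M B d s)"
| "safe M B (While b c) s \<longleftrightarrow> False"

primrec cost :: "com \<Rightarrow> nat" where
  "cost Skip = 1"
| "cost (Assign x e) = 1 + acost e"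
| "cost (Put a e f) = 1 + acost e + acost f"
| "cost (Seq c d) = cost c + cost d"
| "cost (If b c d) = 1 + bcost b + cost c + cost d"
| "cost (While b c) = 0"

text \<open>The actual time counts only the branch taken, while \<open>cost\<close> adds both
  branches of a conditional. This makes the bound independent of the state and computable by the
  simplifier.\<close>

lemma exec_run:
  assumes "safe M B c s"
  shows "\<exists>t\<le>cost c. exec M B c s t (run M c s)"
  using assms
proof (induction c arbitrary: s)
  case Skip
  then show ?case using exec.Skip by auto
next
  case (Assign x e)
  then show ?case using exec.Assign[of B s e] by auto
next
  case (Put a e f)
  then show ?case using exec.Put[of B s e f] by auto
next
  case (Seq c d)
  then obtain t u where "t \<le> cost c" "exec M B c s t (run M c s)"
    "u \<le> cost d" "exec M B d (run M c s) u (run M d (run M c s))"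
    by (metis safe.simps(4))
  then show ?case
    by (auto intro!: exI[of _ "t + u"] exec.Seq)
next
  case (If b c d)
  show ?case
  proof (cases "bval M s b")
    case True
    then obtain t where "t \<le> cost c" "exec M B c s t (run M c s)"
      using If by auto
    then show ?thesis
      using True If.prems by (auto intro!: exI[of _ "1 + bcost b + t"] exec.IfTrue[simplified])
  next
    case False
    then obtain t where "t \<le> cost d" "exec M B d s t (run M d s)"
      using If by auto
    then show ?thesis
      using False If.prems by (auto intro!: exI[of _ "1 + bcost b + t"] exec.IfFalse[simplified])
  qed
qed simp

lemma runs_straight:
  assumes "safe M B c s" and "cost c \<le> T" and "Q (run M c s)"
  shows "runs M B c s T Q"
  using exec_run[OF assms(1)] assms(2,3) unfolding runs_def by (meson order_trans)

subsection \<open>Number of halvings\<close>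

text \<open>The bit length of \<open>n\<close>. The recursion imitates the loops below, which halve
  a quantity until it reaches 0, so one round of a loop corresponds to one unfolding.\<close>

fun lev :: "nat \<Rightarrow> nat" where
  "lev n = (if n = 0 then 0 else Suc (lev (n div 2)))"

declare lev.simps [simp del]

lemma lev_0 [simp]: "lev 0 = 0"
  by (simp add: lev.simps)

lemma lev_pos: "0 < n \<Longrightarrow> lev n = Suc (lev (n div 2))"
  by (subst lev.simps) simp

lemma lev_mono: "m \<le> n \<Longrightarrow> lev m \<le> lev n"
proof (induction n arbitrary: m rule: less_induct)
  case (less n)
  show ?case
  proof (cases "m = 0")
    case False
    then show ?thesis
      using less.IH[of "n div 2" "m div 2"] less.prems by (simp add: lev_pos div_le_mono)
  qed simp
qed

lemma less_power_lev: "n < 2 ^ lev n"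
proof (induction n rule: less_induct)
  case (less n)
  show ?case
  proof (cases "n = 0")
    case False
    then show ?thesis
      using less.IH[of "n div 2"] by (simp add: lev_pos)
  qed simp
qed

lemma power_lev_le: "0 < n \<Longrightarrow> 2 ^ lev n \<le> 2 * n"
proof (induction n rule: less_induct)
  case (less n)
  show ?case
  proof (cases "n = 1")
    case True
    then show ?thesis by (simp add: lev_pos)
  next
    case False
    then show ?thesis
      using less.IH[of "n div 2"] less.prems by (simp add: lev_pos)
  qed
qed

lemma lev_le: "lev n \<le> n"
proof (induction n rule: less_induct)
  case (less n)
  show ?case
  proof (cases "n = 0")
    case False
    then show ?thesis
      using less.IH[of "n div 2"] by (simp add: lev_pos)
  qed simp
qed

text \<open>With its converse below, this links the tree loops, which only see repeatedly halved
  numbers, to the levels \<open>k < lev n\<close> of the tree: the guard fails no later than after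
  the last level.\<close>

lemma div_power_pos_imp_less_lev:
  assumes "0 < n div 2 ^ k"
  shows "k < lev n"
proof (rule ccontr)
  assume "\<not> k < lev n"
  then have "(2 :: nat) ^ lev n \<le> 2 ^ k" by simp
  with less_power_lev[of n] have "n < 2 ^ k" by linarith
  with assms show False by simp
qed

lemma less_lev_imp_div_power_pos:
  assumes "k < lev n"
  shows "0 < n div 2 ^ k"
proof -
  have "n > 0" using assms by (cases n) auto
  have "(2 :: nat) ^ Suc k \<le> 2 ^ lev n"
    using assms by (simp only: Suc_leI power_increasing)
  then have "(2 :: nat) ^ k \<le> n"
    using power_lev_le[OF \<open>n > 0\<close>] by simp
  then show ?thesis by (simp add: div_greater_zero_iff)
qed

subsection \<open>Binary search\<close>

text \<open>The variable \<open>a\<close> is set by the caller to the place where the search starts.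
  The end found is exclusive and is left in \<open>b\<close>, whose initial value \<open>n\<close>
  serves as a sentinel.\<close>

definition bisect :: "bexp \<Rightarrow> com" where
  "bisect t =
     Seq (Assign ''b'' (V ''n''))
       (While (Less (N 1) (Sub (V ''b'') (V ''a'')))
         (Seq (Assign ''c'' (Quot (Add (V ''a'') (V ''b'')) (N 2)))
           (If t (Assign ''a'' (V ''c'')) (Assign ''b'' (V ''c'')))))"

definition same_except :: "string set \<Rightarrow> state \<Rightarrow> state \<Rightarrow> bool" where
  "same_except X s s' \<longleftrightarrow> (\<forall>x. x \<notin> X \<longrightarrow> vars s' x = vars s x)"

text \<open>Each round halves the number of open positions between \<open>a\<close> and
  \<open>b\<close>. The factor 40 covers the guard, the midpoint, a test of cost at most 10 and both
  assignments.\<close>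

lemma runs_bisect:
  assumes n: "vars s ''n'' = n" and a: "vars s ''a'' = k" "k < n" and B: "(n + 2)\<^sup>2 \<le> B"
    and test: "\<And>s'. same_except {''a'', ''b'', ''c''} s s' \<Longrightarrow> arrs s' = arrs s \<Longrightarrow>
      vars s' ''c'' < n \<Longrightarrow> bfits B s' t \<and> (bval M s' t \<longleftrightarrow> P (vars s' ''c''))"
    and mono: "\<And>i j. k < i \<Longrightarrow> i < j \<Longrightarrow> j < n \<Longrightarrow> P j \<Longrightarrow> P i"
    and cost: "bcost t \<le> 10"
  shows "runs M B (bisect t) s (40 * lev n + 10) (\<lambda>s'.
    same_except {''a'', ''b'', ''c''} s s' \<and> arrs s' = arrs s \<and>
    k < vars s' ''b'' \<and> vars s' ''b'' \<le> n \<and> (\<forall>j. k < j \<longrightarrow> j < n \<longrightarrow> (P j \<longleftrightarrow> j < vars s' ''b'')))"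
proof -
  have Bn: "2 < B" "2 * n < B"
    using B by (auto simp: power2_eq_square)
  \<comment> \<open>In every use \<open>k\<close> is the place of the current partner, where strict
    preference fails; hence \<open>P\<close> is demanded of \<open>a\<close> only after it has
    moved, and its negation of \<open>b\<close> only below the sentinel \<open>n\<close>. The last
    conjunct charges each round to a bit of the number \<open>b - a - 1\<close> of open
    positions.\<close>
  define I where "I = (\<lambda>i s'. same_except {''a'', ''b'', ''c''} s s' \<and> arrs s' = arrs s \<and>
    k \<le> vars s' ''a'' \<and> vars s' ''a'' < vars s' ''b'' \<and> vars s' ''b'' \<le> n \<and>
    (k < vars s' ''a'' \<longrightarrow> P (vars s' ''a'')) \<and> (vars s' ''b'' < n \<longrightarrow> \<not> P (vars s' ''b'')) \<and>
    i + lev (vars s' ''b'' - vars s' ''a'' - 1) \<le> lev n)"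
  let ?b = "Less (N 1) (Sub (V ''b'') (V ''a''))"
  let ?c = "Seq (Assign ''c'' (Quot (Add (V ''a'') (V ''b'')) (N 2)))
           (If t (Assign ''a'' (V ''c'')) (Assign ''b'' (V ''c'')))"
  have step: "i < lev n \<and> runs M B ?c s1 30 (I (Suc i))"
    if I: "I i s1" and b: "bval M s1 ?b" for i s1
  proof -
    define a where "a = vars s1 ''a''"
    define b where "b = vars s1 ''b''"
    define c where "c = (a + b) div 2"
    have ab: "a + 1 < b" "k \<le> a" "b \<le> n"
      using I b by (auto simp: I_def a_def b_def)
    have c: "a < c" "c < b" using ab by (auto simp: c_def)
    define s2 where "s2 = s1\<lparr>vars := (vars s1)(''c'' := c)\<rparr>"
    have s2: "bfits B s2 t" "bval M s2 t \<longleftrightarrow> P c"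
      using test[of s2] I c ab by (auto simp: I_def s2_def same_except_def)
    have lev: "lev (b - a - 1) = Suc (lev ((b - a - 1) div 2))"
      using ab by (intro lev_pos) simp
    have "i + lev (b - a - 1) \<le> lev n"
      using I by (simp add: I_def a_def b_def)
    with lev have *: "Suc i + lev ((b - a - 1) div 2) \<le> lev n" by simp
    have le: "b - c - 1 \<le> (b - a - 1) div 2" "c - a - 1 \<le> (b - a - 1) div 2"
      using ab unfolding c_def by linarith+
    have lv: "Suc i + lev (b - c - 1) \<le> lev n" "Suc i + lev (c - a - 1) \<le> lev n"
      using * le[THEN lev_mono] by linarith+
    have "safe M B ?c s1"
      using s2 Bn ab c by (simp flip: a_def b_def c_def s2_def) (simp add: s2_def)
    moreover have "I (Suc i) (run M ?c s1)"
    proof (cases "P c")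
      case True
      then have "run M ?c s1 = s2\<lparr>vars := (vars s2)(''a'' := c)\<rparr>"
        using s2(2) by (simp flip: a_def b_def c_def s2_def) (simp add: s2_def)
      then show ?thesis
        using I True c ab lv by (auto simp: I_def same_except_def s2_def b_def)
    next
      case False
      then have "run M ?c s1 = s2\<lparr>vars := (vars s2)(''b'' := c)\<rparr>"
        using s2(2) by (simp flip: a_def b_def c_def s2_def) (simp add: s2_def)
      then show ?thesis
        using I False c ab lv by (auto simp: I_def same_except_def s2_def a_def)
    qed
    ultimately show ?thesis
      using * cost by (intro conjI runs_straight) (assumption | simp)+
  qed
  show ?thesis
    unfolding bisect_def
  proof (rule runs_weaken[OF runs_Seq[where T = 2 and
          U = "lev n * (1 + bcost ?b + 30) + 1 + bcost ?b" and P = "I 0"]])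
    show "runs M B (Assign ''b'' (V ''n'')) s 2 (I 0)"
      using n a Bn by (intro runs_straight) (auto simp: I_def same_except_def intro: lev_mono)
    show "runs M B (While ?b ?c) s' (lev n * (1 + bcost ?b + 30) + 1 + bcost ?b)
            (\<lambda>s. \<exists>k. I k s \<and> \<not> bval M s ?b)" if "I 0 s'" for s'
    proof (rule runs_While[where I = I])
      show "bfits B s1 ?b" if "I i s1" for i s1
        using that Bn by (auto simp: I_def)
    qed (use that step in auto)
    show "2 + (lev n * (1 + bcost ?b + 30) + 1 + bcost ?b) \<le> 40 * lev n + 10" by simp
    fix s' assume "\<exists>k. I k s' \<and> \<not> bval M s' ?b"
    then obtain i where I: "I i s'" and "\<not> bval M s' ?b" by blast
    then have ba: "vars s' ''b'' = vars s' ''a'' + 1" by (auto simp: I_def)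
    have "P j \<longleftrightarrow> j < vars s' ''b''" if j: "k < j" "j < n" for j
    proof (cases "j < vars s' ''b''")
      case True
      then consider "j = vars s' ''a''" | "j < vars s' ''a''" using ba by linarith
      then show ?thesis
        using I j True mono[of j "vars s' ''a''"] by cases (auto simp: I_def)
    next
      case False
      then show ?thesis
        using I j mono[of "vars s' ''b''" j] by (cases "j = vars s' ''b''") (auto simp: I_def)
    qed
    with I show "same_except {''a'', ''b'', ''c''} s s' \<and> arrs s' = arrs s \<and>
      k < vars s' ''b'' \<and> vars s' ''b'' \<le> n \<and> (\<forall>j. k < j \<longrightarrow> j < n \<longrightarrow> (P j \<longleftrightarrow> j < vars s' ''b''))"
      by (auto simp: I_def)
  qed
qed


subsection \<open>A tree of maxima\<close>

text \<open>
  Level \<open>k\<close> of the tree occupies the array cells from \<open>k * n\<close> on; its \<open>j\<close>-th node stands for the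
  leaves \<open>w\<close> with \<open>w div 2 ^ k = j\<close> and stores the maximum of the values \<open>v w\<close>.
\<close>

definition level_rep :: "nat \<Rightarrow> (nat \<Rightarrow> nat) \<Rightarrow> (nat \<Rightarrow> nat) \<Rightarrow> nat \<Rightarrow> bool" where
  "level_rep n A v k \<longleftrightarrow>
     (\<forall>j<n. \<forall>x. x < A (k * n + j) \<longleftrightarrow> (\<exists>w<n. w div 2 ^ k = j \<and> x < v w))"

definition tree_rep :: "nat \<Rightarrow> (nat \<Rightarrow> nat) \<Rightarrow> (nat \<Rightarrow> nat) \<Rightarrow> bool" where
  "tree_rep n A v \<longleftrightarrow> (\<forall>k<lev n. level_rep n A v k)"

lemma level_rep_le:
  assumes "level_rep n A v k" and "\<And>w. w < n \<Longrightarrow> v w \<le> n" and "j < n"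
  shows "A (k * n + j) \<le> n"
  using assms unfolding level_rep_def by (meson linorder_not_less)

text \<open>Offsets are below \<open>n\<close>, so division by \<open>n\<close> recovers the level
  from a cell index, and different levels never share a cell.\<close>

lemma level_rep_upd_other:
  assumes "level_rep n A v k'" and "k' \<noteq> k" and "j < n"
  shows "level_rep n (A(k * n + j := y)) v k'"
proof -
  have "k' * n + j' \<noteq> k * n + j" if "j' < n" for j'
  proof
    assume "k' * n + j' = k * n + j"
    then have "(k' * n + j') div n = (k * n + j) div n" by simp
    with that assms show False by simp
  qed
  with assms(1) show ?thesis by (simp add: level_rep_def)
qed

text \<open>Describing a maximum by the thresholds below it makes the update a disjunction, and a
  node without leaves needs no special case: its cell holds 0.\<close>

lemma level_rep_insert:
  assumes "level_rep n A v k" and "w < n"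
  shows "level_rep n (A(k * n + w div 2 ^ k := max (A (k * n + w div 2 ^ k)) y))
           (v(w := max (v w) y)) k"
  unfolding level_rep_def
proof (intro allI impI)
  fix j x assume "j < n"
  then have "x < A (k * n + j) \<longleftrightarrow> (\<exists>w<n. w div 2 ^ k = j \<and> x < v w)"
    using assms(1) by (simp add: level_rep_def)
  with assms(2)
  show "x < (A(k * n + w div 2 ^ k := max (A (k * n + w div 2 ^ k)) y)) (k * n + j) \<longleftrightarrow>
    (\<exists>w'<n. w' div 2 ^ k = j \<and> x < (v(w := max (v w) y)) w')"
    by (cases "j = w div 2 ^ k") (auto simp: less_max_iff_disj)
qed

text \<open>The crude estimate \<open>lev n \<le> n\<close> is good enough, since the word bound is
  quadratic in \<open>n\<close> anyway.\<close>

lemma node_index_le: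
  fixes k n :: nat
  assumes "k \<le> lev n"
  shows "k * n \<le> n * n"
  using assms lev_le[of n] by (intro mult_right_mono) auto

text \<open>The program variable \<open>k\<close> is not the level. It holds \<open>n\<close> halved
  once per round and reaches 0 after exactly \<open>lev n\<close> rounds, so the program never has
  to compute the number of levels; \<open>base\<close> is the level times \<open>n\<close>.\<close>

definition tree_insert :: "string \<Rightarrow> com" where
  "tree_insert r =
     Seq (Seq (Assign ''k'' (V ''n'')) (Seq (Assign ''base'' (N 0)) (Assign ''c'' (V ''w''))))
       (While (Less (N 0) (V ''k''))
         (Seq (If (Less (Get r (Add (V ''base'') (V ''c''))) (V ''b''))
                 (Put r (Add (V ''base'') (V ''c'')) (V ''b'')) Skip)
         (Seq (Assign ''c'' (Quot (V ''c'') (N 2)))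
         (Seq (Assign ''base'' (Add (V ''base'') (V ''n'')))
              (Assign ''k'' (Quot (V ''k'') (N 2)))))))"

lemma runs_tree_insert:
  assumes n: "vars s ''n'' = n" and w: "vars s ''w'' = w" "w < n"
    and b: "vars s ''b'' = y" "y \<le> n" and B: "(n + 2)\<^sup>2 \<le> B"
    and rep: "tree_rep n (arrs s r) v" and v: "\<And>u. u < n \<Longrightarrow> v u \<le> n"
  shows "runs M B (tree_insert r) s (50 * lev n + 20) (\<lambda>s'.
    same_except {''k'', ''base'', ''c''} s s' \<and> (\<forall>a. a \<noteq> r \<longrightarrow> arrs s' a = arrs s a) \<and>
    tree_rep n (arrs s' r) (v(w := max (v w) y)))"
proof -
  have Bn: "2 < B" "n * n + 4 * n < B"
    using B by (auto simp: power2_eq_square algebra_simps)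
  let ?v = "v(w := max (v w) y)"
  define I where "I = (\<lambda>k s'. same_except {''k'', ''base'', ''c''} s s' \<and>
    (\<forall>a. a \<noteq> r \<longrightarrow> arrs s' a = arrs s a) \<and> k \<le> lev n \<and>
    vars s' ''k'' = n div 2 ^ k \<and> vars s' ''base'' = k * n \<and> vars s' ''c'' = w div 2 ^ k \<and>
    (\<forall>k'<lev n. level_rep n (arrs s' r) (if k' < k then ?v else v) k'))"
  let ?b = "Less (N 0) (V ''k'')"
  let ?c = "Seq (If (Less (Get r (Add (V ''base'') (V ''c''))) (V ''b''))
                 (Put r (Add (V ''base'') (V ''c'')) (V ''b'')) Skip)
         (Seq (Assign ''c'' (Quot (V ''c'') (N 2)))
         (Seq (Assign ''base'' (Add (V ''base'') (V ''n'')))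
              (Assign ''k'' (Quot (V ''k'') (N 2)))))"
  have step: "k < lev n \<and> runs M B ?c s1 40 (I (Suc k))"
    if I: "I k s1" and b: "bval M s1 ?b" for k s1
  proof -
    have vs: "vars s1 ''n'' = n" "vars s1 ''b'' = y" "vars s1 ''k'' = n div 2 ^ k"
      "vars s1 ''base'' = k * n" "vars s1 ''c'' = w div 2 ^ k"
      using I n assms(4) by (auto simp: I_def same_except_def)
    have k: "k < lev n"
      using b vs by (simp add: div_power_pos_imp_less_lev)
    have wn: "w div 2 ^ k < n" using w(2) by (meson div_le_dividend order_le_less_trans)
    have rk: "level_rep n (arrs s1 r) v k"
      using I k by (auto simp: I_def)
    define A where "A = arrs s1 r (k * n + w div 2 ^ k)"
    have A: "A \<le> n"
      unfolding A_def using rk v wn by (rule level_rep_le)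
    have kn: "k * n \<le> n * n" by (rule node_index_le[OF less_imp_le[OF k]])
    have fits: "y < B" "A < B" "k * n + w div 2 ^ k < B" "w div 2 ^ k < B" "k * n + n < B"
      "n div 2 ^ k < B" "n div 2 ^ k div 2 < B" "w div 2 ^ k div 2 < B" "k * n < B" "n < B"
      using Bn A kn wn assms(5) div_le_dividend[of n "2 ^ k"] by linarith+
    have "safe M B ?c s1"
      using fits Bn(1) by (auto simp: vs simp flip: A_def)
    moreover have "I (Suc k) (run M ?c s1)"
    proof -
      define A' where "A' = (arrs s1 r)(k * n + w div 2 ^ k := max A y)"
      have arr: "arrs (run M ?c s1) = (arrs s1)(r := A')"
        by (auto simp: vs A'_def A_def max_def fun_eq_iff)
      have run: "vars (run M ?c s1) = (vars s1)(''c'' := w div 2 ^ k div 2,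
          ''base'' := k * n + n, ''k'' := n div 2 ^ k div 2)"
        by (auto simp: vs fun_eq_iff)
      have "level_rep n A' (if k' < Suc k then ?v else v) k'" if "k' < lev n" for k'
      proof (cases "k' = k")
        case True
        then show ?thesis
          unfolding A'_def A_def using level_rep_insert[OF rk w(2), of y] by simp
      next
        case False
        moreover have "level_rep n (arrs s1 r) (if k' < k then ?v else v) k'"
          using I that by (simp add: I_def)
        ultimately show ?thesis
          unfolding A'_def using wn by (auto intro!: level_rep_upd_other simp: less_Suc_eq)
      qed
      then show ?thesis
        using I k unfolding I_def arr run
        by (simp add: same_except_def div_mult2_eq mult.commute[of 2])
    qed
    moreover have "cost ?c \<le> 40" by simp
    ultimately show ?thesis
      using k by (blast intro: runs_straight)
  qed
  show ?thesis
    unfolding tree_insert_def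
  proof (rule runs_weaken[OF runs_Seq[where T = 10 and
          U = "lev n * (1 + bcost ?b + 40) + 1 + bcost ?b" and P = "I 0"]])
    show "runs M B (Seq (Assign ''k'' (V ''n'')) (Seq (Assign ''base'' (N 0)) (Assign ''c'' (V ''w''))))
      s 10 (I 0)"
      using n w rep Bn by (intro runs_straight) (auto simp: I_def same_except_def tree_rep_def)
    show "runs M B (While ?b ?c) s' (lev n * (1 + bcost ?b + 40) + 1 + bcost ?b)
            (\<lambda>s. \<exists>k. I k s \<and> \<not> bval M s ?b)" if "I 0 s'" for s'
    proof (rule runs_While[where I = I])
      show "bfits B s1 ?b" if "I k s1" for k s1
      proof -
        have "n div 2 ^ k < B" using Bn div_le_dividend[of n "2 ^ k"] by linarith
        with that Bn show ?thesis by (auto simp: I_def)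
      qed
    qed (use that step in auto)
    show "10 + (lev n * (1 + bcost ?b + 40) + 1 + bcost ?b) \<le> 50 * lev n + 20" by simp
    fix s' assume "\<exists>k. I k s' \<and> \<not> bval M s' ?b"
    then obtain k where I: "I k s'" and "\<not> bval M s' ?b" by blast
    then have "\<not> k < lev n" using less_lev_imp_div_power_pos[of k n] by (auto simp: I_def)
    with I show "same_except {''k'', ''base'', ''c''} s s' \<and>
      (\<forall>a. a \<noteq> r \<longrightarrow> arrs s' a = arrs s a) \<and> tree_rep n (arrs s' r) ?v"
      by (auto simp: I_def tree_rep_def)
  qed
qed

text \<open>Rounding \<open>l\<close> up and \<open>h\<close> down keeps exactly the parents with
  both children in the range, and only the outermost nodes \<open>l\<close> and \<open>h - 1\<close>
  can lose their parent in this way. They may also be covered twice, which is harmless for a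
  maximum.\<close>

lemma range_halve:
  fixes l h u :: nat
  assumes "l < h"
  shows "l \<le> u \<and> u < h \<longleftrightarrow>
    (l \<le> u \<and> u < Suc l) \<or> (h - 1 \<le> u \<and> u < h) \<or> (Suc l div 2 \<le> u div 2 \<and> u div 2 < h div 2)"
proof -
  have "Suc l div 2 \<le> u div 2 \<and> u div 2 < h div 2" if "Suc l \<le> u" "u + 2 \<le> h"
    using div_le_mono[OF that(1), of 2] div_le_mono[OF that(2), of 2] by simp
  moreover have "l \<le> u" if "Suc l div 2 \<le> u div 2"
    using that by linarith
  moreover have "u < h" if "u div 2 < h div 2"
    using that by (meson div_le_mono linorder_not_le)
  ultimately show ?thesis using assms by force
qed

text \<open>
  At each level the two outermost nodes of the range are inspected. All other nodes of the range
  are covered by parents with both children in the range.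
\<close>

definition tree_query :: "string \<Rightarrow> com" where
  "tree_query r =
     Seq (Assign ''base'' (N 0))
       (While (Less (V ''lo'') (V ''hi''))
         (Seq (If (Less (V ''i'') (Get r (Add (V ''base'') (V ''lo'')))) (Assign ''result'' (N 0)) Skip)
         (Seq (If (Less (V ''i'') (Get r (Sub (Add (V ''base'') (V ''hi'')) (N 1))))
                 (Assign ''result'' (N 0)) Skip)
         (Seq (Assign ''lo'' (Quot (Add (V ''lo'') (N 1)) (N 2)))
         (Seq (Assign ''hi'' (Quot (V ''hi'') (N 2)))
              (Assign ''base'' (Add (V ''base'') (V ''n''))))))))"

lemma runs_tree_query:
  assumes n: "vars s ''n'' = n" and i: "vars s ''i'' = x" "x \<le> n"
    and lo: "vars s ''lo'' = lo" "lo \<le> n" and hi: "vars s ''hi'' = hi" "hi \<le> n"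
    and B: "(n + 2)\<^sup>2 \<le> B"
    and rep: "tree_rep n (arrs s r) v" and v: "\<And>u. u < n \<Longrightarrow> v u \<le> n"
  shows "runs M B (tree_query r) s (60 * lev n + 20) (\<lambda>s'.
    same_except {''lo'', ''hi'', ''base'', ''result''} s s' \<and> arrs s' = arrs s \<and>
    vars s' ''result'' =
      (if \<exists>u<n. lo \<le> u \<and> u < hi \<and> x < v u then 0 else vars s ''result''))"
proof -
  have Bn: "2 < B" "n * n + 4 * n < B"
    using B by (auto simp: power2_eq_square algebra_simps)
  define R where "R = (if \<exists>u<n. lo \<le> u \<and> u < hi \<and> x < v u then 0 else vars s ''result'')"
  define E where "E = (\<lambda>k l h. \<exists>u<n. l \<le> u div 2 ^ k \<and> u div 2 ^ k < h \<and> x < v u)"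
  \<comment> \<open>\<open>R\<close> is the final answer: the part of the query still open at level
    \<open>k\<close>, combined with the current flag, must yield it. The bound
    \<open>n div 2 ^ k\<close> on \<open>hi\<close> makes the range empty at level
    \<open>lev n\<close>, which limits the rounds and keeps all accesses inside the tree.\<close>
  define I where "I = (\<lambda>k s'. same_except {''lo'', ''hi'', ''base'', ''result''} s s' \<and>
    arrs s' = arrs s \<and> k \<le> lev n \<and> vars s' ''lo'' \<le> n \<and> vars s' ''hi'' \<le> n div 2 ^ k \<and>
    vars s' ''base'' = k * n \<and>
    (if E k (vars s' ''lo'') (vars s' ''hi'') then 0 else vars s' ''result'') = R)"
  let ?b = "Less (V ''lo'') (V ''hi'')"
  let ?c = "Seq (If (Less (V ''i'') (Get r (Add (V ''base'') (V ''lo'')))) (Assign ''result'' (N 0)) Skip)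
         (Seq (If (Less (V ''i'') (Get r (Sub (Add (V ''base'') (V ''hi'')) (N 1))))
                 (Assign ''result'' (N 0)) Skip)
         (Seq (Assign ''lo'' (Quot (Add (V ''lo'') (N 1)) (N 2)))
         (Seq (Assign ''hi'' (Quot (V ''hi'') (N 2)))
              (Assign ''base'' (Add (V ''base'') (V ''n''))))))"
  have step: "k < lev n \<and> runs M B ?c s1 50 (I (Suc k))"
    if I: "I k s1" and b: "bval M s1 ?b" for k s1
  proof -
    define l where "l = vars s1 ''lo''"
    define h where "h = vars s1 ''hi''"
    have vs: "vars s1 ''n'' = n" "vars s1 ''i'' = x" "vars s1 ''lo'' = l" "vars s1 ''hi'' = h"
      "vars s1 ''base'' = k * n"
      using I n i by (auto simp: I_def same_except_def l_def h_def)
    have lh: "l < h" "h \<le> n div 2 ^ k"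
      using b I by (auto simp: vs I_def)
    have k: "k < lev n"
      using lh by (intro div_power_pos_imp_less_lev) linarith
    have hn: "h \<le> n" using lh(2) div_le_dividend order_trans by blast
    have rk: "level_rep n (arrs s1 r) v k"
      using I k rep by (auto simp: I_def tree_rep_def)
    define Al where "Al = arrs s1 r (k * n + l)"
    define Ah where "Ah = arrs s1 r (k * n + (h - 1))"
    have A: "Al \<le> n" "Ah \<le> n"
      unfolding Al_def Ah_def using lh hn by (intro level_rep_le[OF rk v]; simp)+
    \<comment> \<open>The program subtracts 1 from the whole index; as \<open>h\<close> is positive,
      truncated subtraction reaches the same cell.\<close>
    have Ah': "arrs s1 r (k * n + h - Suc 0) = Ah"
      using lh by (simp add: Ah_def)
    have kn: "k * n \<le> n * n" by (rule node_index_le[OF less_imp_le[OF k]])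
    have fits: "x < B" "Al < B" "Ah < B" "k * n + l < B" "k * n + h < B" "k * n + h - Suc 0 < B"
      "h < B" "l < B" "l + 1 < B" "k * n < B" "n < B" "k * n + n < B" "h div 2 < B" "(l + 1) div 2 < B"
      using Bn A kn lh hn i(2) by linarith+
    have Alx: "x < Al \<longleftrightarrow> E k l (Suc l)"
      using rk lh hn unfolding level_rep_def Al_def E_def by (auto simp: less_Suc_eq_le)
    have Ahx: "x < Ah \<longleftrightarrow> E k (h - 1) h"
    proof -
      have "x < Ah \<longleftrightarrow> (\<exists>w<n. w div 2 ^ k = h - 1 \<and> x < v w)"
        unfolding Ah_def using lh hn
        by (intro rk[unfolded level_rep_def, rule_format]) linarith
      moreover have "u = h - 1 \<longleftrightarrow> h - 1 \<le> u \<and> u < h" for u using lh by linarith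
      ultimately show ?thesis unfolding E_def by metis
    qed
    have E: "E k l h \<longleftrightarrow> x < Al \<or> x < Ah \<or> E (Suc k) (Suc l div 2) (h div 2)"
    proof -
      define e where "e = (\<lambda>(k :: nat) l h (u :: nat). l \<le> u div 2 ^ k \<and> u div 2 ^ k < h)"
      have "e k l h u \<longleftrightarrow> e k l (Suc l) u \<or> e k (h - 1) h u \<or> e (Suc k) (Suc l div 2) (h div 2) u" for u
        using range_halve[OF lh(1), of "u div 2 ^ k"]
        by (simp add: e_def div_mult2_eq mult.commute[of 2])
      moreover have "E k l h \<longleftrightarrow> (\<exists>u<n. e k l h u \<and> x < v u)" for k l h
        by (simp add: E_def e_def)
      ultimately show ?thesis
        unfolding Alx Ahx by blast
    qed
    have "safe M B ?c s1"
      using fits Bn(1) by (simp add: vs Ah' flip: Al_def)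
    moreover have "I (Suc k) (run M ?c s1)"
    proof -
      define y where "y = (if x < Al \<or> x < Ah then 0 else vars s1 ''result'')"
      have run: "vars (run M ?c s1) = (vars s1)(''result'' := y, ''lo'' := Suc l div 2,
          ''hi'' := h div 2, ''base'' := k * n + n)"
        "arrs (run M ?c s1) = arrs s1"
        by (auto simp: vs Ah' y_def fun_eq_iff simp flip: Al_def)
      have R: "(if E k l h then 0 else vars s1 ''result'') = R"
        using I unfolding I_def vs by blast
      have "h div 2 \<le> n div 2 ^ k div 2"
        using lh by (simp add: div_le_mono)
      then have "h div 2 \<le> n div 2 ^ Suc k" by (simp add: div_mult2_eq mult.commute[of 2])
      moreover have "E (Suc k) (Suc l div 2) (h div 2) \<longrightarrow> R = 0"
        "\<not> E (Suc k) (Suc l div 2) (h div 2) \<longrightarrow> y = R"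
        using R E unfolding y_def by presburger+
      moreover have "Suc l div 2 \<le> n" using lh hn by linarith
      moreover have "same_except {''lo'', ''hi'', ''base'', ''result''} s s1" "arrs s1 = arrs s"
        using I by (simp_all add: I_def)
      ultimately show ?thesis
        using k unfolding I_def run same_except_def by simp
    qed
    moreover have "cost ?c \<le> 50" by simp
    ultimately show ?thesis
      using k by (blast intro: runs_straight)
  qed
  show ?thesis
    unfolding tree_query_def
  proof (rule runs_weaken[OF runs_Seq[where T = 2 and
          U = "lev n * (1 + bcost ?b + 50) + 1 + bcost ?b" and P = "I 0"]])
    show "runs M B (Assign ''base'' (N 0)) s 2 (I 0)"
      using n lo hi Bn by (intro runs_straight) (auto simp: I_def same_except_def R_def E_def)
    show "runs M B (While ?b ?c) s' (lev n * (1 + bcost ?b + 50) + 1 + bcost ?b)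
            (\<lambda>s. \<exists>k. I k s \<and> \<not> bval M s ?b)" if "I 0 s'" for s'
    proof (rule runs_While[where I = I])
      show "bfits B s1 ?b" if "I k s1" for k s1
      proof -
        have "vars s1 ''lo'' \<le> n" "vars s1 ''hi'' \<le> n"
          using that div_le_dividend[of n "2 ^ k"] by (auto simp: I_def simp del: div_le_dividend)
        with Bn show ?thesis by simp
      qed
    qed (use that step in auto)
    show "2 + (lev n * (1 + bcost ?b + 50) + 1 + bcost ?b) \<le> 60 * lev n + 20" by simp
    fix s' assume "\<exists>k. I k s' \<and> \<not> bval M s' ?b"
    then obtain k where I: "I k s'" and "\<not> bval M s' ?b" by blast
    then have "\<not> E k (vars s' ''lo'') (vars s' ''hi'')" by (auto simp: E_def)
    with I have "vars s' ''result'' = R" by (simp add: I_def)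
    with I show "same_except {''lo'', ''hi'', ''base'', ''result''} s s' \<and> arrs s' = arrs s \<and>
      vars s' ''result'' = (if \<exists>u<n. lo \<le> u \<and> u < hi \<and> x < v u then 0 else vars s ''result'')"
      by (simp add: I_def R_def)
  qed
qed


subsection \<open>Sweeping over the men\<close>

text \<open>Reflection of the line, with two uses: it reverses the order in which the men are swept,
  and it turns a search to the left of a partner into one to the right, so that the upward
  \<open>bisect\<close> serves for both.\<close>

definition mirror :: "nat \<Rightarrow> bool \<Rightarrow> nat \<Rightarrow> nat" where
  "mirror n d j = (if d then n - 1 - j else j)"

definition mirror_exp :: "bool \<Rightarrow> aexp \<Rightarrow> aexp" where
  "mirror_exp d e = (if d then Sub (Sub (V ''n'') (N 1)) e else e)"

lemma mirror_less: "j < n \<Longrightarrow> mirror n d j < n"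
  by (auto simp: mirror_def)

lemma mirror_mirror: "j < n \<Longrightarrow> mirror n d (mirror n d j) = j"
  by (auto simp: mirror_def)

lemma mirror_inj: "i < n \<Longrightarrow> j < n \<Longrightarrow> mirror n d i = mirror n d j \<Longrightarrow> i = j"
  by (metis mirror_mirror)

lemma aval_mirror_exp: "aval s (mirror_exp d e) = mirror (vars s ''n'') d (aval s e)"
  by (simp add: mirror_exp_def mirror_def)

lemma afits_mirror_exp:
  "afits B s e \<Longrightarrow> vars s ''n'' < B \<Longrightarrow> 1 < B \<Longrightarrow> afits B s (mirror_exp d e)"
  by (auto simp: mirror_exp_def)

lemma acost_mirror_exp: "acost (mirror_exp d e) \<le> 4 + acost e"
  by (simp add: mirror_exp_def)

text \<open>If \<open>y\<close> is at or before the peak, it beats everything to its left, otherwise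
  everything to its right. One of \<open>x\<close> and \<open>z\<close> lies on that side, so
  \<open>y\<close> beats \<open>x\<close> directly or beats \<open>z\<close>, which beats
  \<open>x\<close>. The points of the line enter the argument only here.\<close>

lemma preferred_between:
  assumes "single_peaked n pref" and "strict_ranking n (pref a)" and "a < n"
    and between: "x < y \<and> y < z \<or> z < y \<and> y < x" and xz: "x < n" "z < n" and "pref a z x"
  shows "pref a y x"
proof -
  obtain p q :: "nat \<Rightarrow> real" where pq: "\<forall>a<n. \<forall>i<n.
      (p i \<le> q a \<longrightarrow> (\<forall>j<i. pref a i j)) \<and>
      (p i \<ge> q a \<longrightarrow> (\<forall>j. i < j \<and> j < n \<longrightarrow> pref a i j))"
    using assms(1) unfolding single_peaked_def by (elim exE conjE) (rule that, assumption)
  have 1: "pref a i j" if "i < n" "p i \<le> q a" "j < i" for i j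
    using pq assms(3) that by simp
  have 2: "pref a i j" if "i < n" "p i \<ge> q a" "i < j" "j < n" for i j
    using pq assms(3) that by simp
  have y: "y < n" using between xz by linarith
  have "pref a y x \<or> pref a y z"
  proof (cases "p y \<le> q a")
    case True
    then show ?thesis using 1[OF y True] between by blast
  next
    case False
    then have "p y \<ge> q a" by simp
    then show ?thesis using 2[OF y] between xz by blast
  qed
  moreover have "pref a y x" if "pref a y z"
    using assms(2) that \<open>pref a z x\<close> xz y unfolding strict_ranking_def
    by (meson transp_onD lessThan_iff)
  ultimately show ?thesis by blast
qed

lemma mirror_between:
  assumes "k < i" and "i < j" and "j < n"
  shows "mirror n d k < mirror n d i \<and> mirror n d i < mirror n d j \<or>
    mirror n d j < mirror n d i \<and> mirror n d i < mirror n d k"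
  using assms by (auto simp: mirror_def)

section \<open>The checking programs\<close>

definition men_range :: "bool \<Rightarrow> com" where
  "men_range d =
     Seq (Seq (Assign ''m'' (mirror_exp d (V ''i'')))
           (Seq (Assign ''w'' (Get ''mu'' (V ''m''))) (Assign ''a'' (V ''w''))))
    (Seq (bisect (MenPref (V ''m'') (V ''c'') (V ''w'')))
    (Seq (Seq (Assign ''hi'' (V ''b'')) (Assign ''a'' (mirror_exp True (V ''w''))))
    (Seq (bisect (MenPref (V ''m'') (mirror_exp True (V ''c'')) (V ''w'')))
         (Assign ''lo'' (Sub (V ''n'') (V ''b''))))))"

definition sweep_body :: "bool \<Rightarrow> string \<Rightarrow> com" where
  "sweep_body d r =
     Seq (men_range d)
    (Seq (tree_query r)
    (Seq (Assign ''a'' (V ''i''))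
    (Seq (bisect (WomenPref (V ''w'') (mirror_exp d (V ''c'')) (V ''m'')))
    (Seq (tree_insert r)
         (Assign ''i'' (Add (V ''i'') (N 1)))))))"

definition sweep :: "bool \<Rightarrow> string \<Rightarrow> com" where
  "sweep d r =
     Seq (Assign ''i'' (N 0)) (While (Less (V ''i'') (V ''n'')) (sweep_body d r))"

definition checker :: com where
  "checker =
     Seq (Assign ''result'' (N 1)) (Seq (sweep False ''up'') (sweep True ''down''))"

section \<open>Correctness on a fixed market and matching\<close>

locale matched_market =
  fixes M :: market and \<mu> :: "nat \<Rightarrow> nat" and n B :: nat
  assumes market: "single_peaked_market M" and matching: "perfect_matching M \<mu>"
    and n: "num M = n" and B: "(n + 2)\<^sup>2 \<le> B"
begin

text \<open>The arguments are positions in the sweep order: the man at \<open>x\<close> blocks with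
  the wife of the man at \<open>y\<close>. Naming the woman by her husband's position lets
  \<open>y < x\<close> express that he comes earlier.\<close>

definition blocks :: "bool \<Rightarrow> nat \<Rightarrow> nat \<Rightarrow> bool" where
  "blocks d x y \<longleftrightarrow>
     men_pref M (mirror n d x) (\<mu> (mirror n d y)) (\<mu> (mirror n d x)) \<and>
     women_pref M (\<mu> (mirror n d y)) (mirror n d x) (mirror n d y)"

definition input_ok :: "state \<Rightarrow> bool" where
  "input_ok s \<longleftrightarrow> vars s ''n'' = n \<and> arrs s ''mu'' = (\<lambda>i. if i < n then \<mu> i else 0)"

lemma Bn: "2 < B" "n * n + 4 * n < B" "n < B" "1 < B"
  using B by (auto simp: power2_eq_square algebra_simps)

lemma matching_less: "m < n \<Longrightarrow> \<mu> m < n"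
  using matching n by (auto simp: perfect_matching_def bij_betw_def)

lemma matching_inj: "m < n \<Longrightarrow> m' < n \<Longrightarrow> \<mu> m = \<mu> m' \<Longrightarrow> m = m'"
  using matching n by (auto simp: perfect_matching_def bij_betw_def inj_on_def)

lemma men_between:
  assumes "m < n" and "k < i" and "i < j" and "j < n"
    and "men_pref M m (mirror n d j) (mirror n d k)"
  shows "men_pref M m (mirror n d i) (mirror n d k)"
proof (rule preferred_between)
  show "single_peaked n (men_pref M)" "strict_ranking n (men_pref M m)"
    using market n assms(1) by (simp_all add: single_peaked_market_def matching_market_def)
qed (use assms mirror_between[OF assms(2-4)] in \<open>simp_all add: mirror_less\<close>)

lemma women_between:
  assumes "w < n" and "k < i" and "i < j" and "j < n"
    and "women_pref M w (mirror n d j) (mirror n d k)"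
  shows "women_pref M w (mirror n d i) (mirror n d k)"
proof (rule preferred_between)
  show "single_peaked n (women_pref M)" "strict_ranking n (women_pref M w)"
    using market n assms(1) by (simp_all add: single_peaked_market_def matching_market_def)
qed (use assms mirror_between[OF assms(2-4)] in \<open>simp_all add: mirror_less\<close>)

text \<open>Preferred women form one run on each side of the own wife by \<open>men_between\<close>,
  and each run is measured by a binary search starting at her. She herself lies between
  \<open>lo\<close> and \<open>hi\<close> without being strictly preferred, hence the exception for
  her.\<close>

lemma runs_men_range:
  assumes s: "input_ok s" and i: "vars s ''i'' = i" "i < n"
  shows "runs M B (men_range d) s (80 * lev n + 60) (\<lambda>s'.
    same_except {''m'', ''w'', ''a'', ''b'', ''c'', ''lo'', ''hi''} s s' \<and> arrs s' = arrs s \<and>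
    vars s' ''m'' = mirror n d i \<and> vars s' ''w'' = \<mu> (mirror n d i) \<and>
    vars s' ''lo'' \<le> n \<and> vars s' ''hi'' \<le> n \<and>
    (\<forall>u<n. u \<noteq> \<mu> (mirror n d i) \<longrightarrow>
      (vars s' ''lo'' \<le> u \<and> u < vars s' ''hi'' \<longleftrightarrow>
       men_pref M (mirror n d i) u (\<mu> (mirror n d i)))))"
proof -
  define m where "m = mirror n d i"
  define w where "w = \<mu> m"
  have m: "m < n" using i by (simp add: m_def mirror_less)
  then have w: "w < n" by (simp add: w_def matching_less)
  let ?X = "{''m'', ''w'', ''a'', ''b'', ''c'', ''lo'', ''hi''}"
  define P where "P = (\<lambda>s'. same_except ?X s s' \<and> arrs s' = arrs s \<and>
     vars s' ''m'' = m \<and> vars s' ''w'' = w)"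
  define H where "H = (\<lambda>b. w < b \<and> b \<le> n \<and> (\<forall>j. w < j \<longrightarrow> j < n \<longrightarrow> (men_pref M m j w \<longleftrightarrow> j < b)))"
  define L where "L = (\<lambda>b. n - 1 - w < b \<and> b \<le> n \<and>
     (\<forall>j. n - 1 - w < j \<longrightarrow> j < n \<longrightarrow> (men_pref M m (n - 1 - j) w \<longleftrightarrow> j < b)))"
  have Pn: "vars s' ''n'' = n" if "P s'" for s'
    using that s by (auto simp: P_def same_except_def input_ok_def)
  have "runs M B (men_range d) s
     (15 + ((40 * lev n + 10) + (15 + ((40 * lev n + 10) + 6))))
     (\<lambda>s'. P s' \<and> H (vars s' ''hi'') \<and> (\<exists>b. L b \<and> vars s' ''lo'' = n - b))"
    unfolding men_range_def
  proof (intro runs_Seq)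
    have "safe M B (Seq (Assign ''m'' (mirror_exp d (V ''i'')))
           (Seq (Assign ''w'' (Get ''mu'' (V ''m''))) (Assign ''a'' (V ''w'')))) s"
      using s i w m Bn by (auto simp: input_ok_def aval_mirror_exp afits_mirror_exp
          simp flip: m_def w_def)
    then show "runs M B (Seq (Assign ''m'' (mirror_exp d (V ''i'')))
           (Seq (Assign ''w'' (Get ''mu'' (V ''m''))) (Assign ''a'' (V ''w'')))) s 15
       (\<lambda>s'. P s' \<and> vars s' ''a'' = w)"
      using s i w m acost_mirror_exp[of d "V ''i''"]
      by (intro runs_straight) (auto simp: P_def same_except_def input_ok_def aval_mirror_exp
          simp flip: m_def w_def)
  next
    fix s' assume s': "P s' \<and> vars s' ''a'' = w"
    show "runs M B (bisect (MenPref (V ''m'') (V ''c'') (V ''w''))) s' (40 * lev n + 10)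
      (\<lambda>s'. P s' \<and> H (vars s' ''b''))"
    proof (rule runs_weaken[OF runs_bisect[where k = w and n = n and P = "\<lambda>j. men_pref M m j w"]])
      show "vars s' ''n'' = n" using s' Pn by blast
      show "bfits B s2 (MenPref (V ''m'') (V ''c'') (V ''w'')) \<and>
        (bval M s2 (MenPref (V ''m'') (V ''c'') (V ''w'')) \<longleftrightarrow> men_pref M m (vars s2 ''c'') w)"
        if "same_except {''a'', ''b'', ''c''} s' s2" "vars s2 ''c'' < n" for s2
        using that s' Bn m w by (auto simp: P_def same_except_def)
      show "men_pref M m i w" if "w < i" "i < j" "j < n" "men_pref M m j w" for i j
        using men_between[of m w i j False] that m by (simp add: mirror_def)
    qed (use s' w B in \<open>auto simp: P_def H_def same_except_def\<close>)
  next
    fix s' assume s': "P s' \<and> H (vars s' ''b'')"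
    have "safe M B (Seq (Assign ''hi'' (V ''b'')) (Assign ''a'' (mirror_exp True (V ''w'')))) s'"
      using s' Pn[of s'] Bn w by (auto simp: P_def H_def intro!: afits_mirror_exp)
    then show "runs M B (Seq (Assign ''hi'' (V ''b'')) (Assign ''a'' (mirror_exp True (V ''w'')))) s' 15
       (\<lambda>s'. P s' \<and> H (vars s' ''hi'') \<and> vars s' ''a'' = n - 1 - w)"
      using s' Pn[of s'] by (intro runs_straight) (auto simp: P_def same_except_def mirror_exp_def)
  next
    fix s' assume s': "P s' \<and> H (vars s' ''hi'') \<and> vars s' ''a'' = n - 1 - w"
    show "runs M B (bisect (MenPref (V ''m'') (mirror_exp True (V ''c'')) (V ''w''))) s' (40 * lev n + 10)
      (\<lambda>s'. P s' \<and> H (vars s' ''hi'') \<and> L (vars s' ''b''))"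
    proof (rule runs_weaken[OF runs_bisect[where k = "n - 1 - w" and n = n and
            P = "\<lambda>j. men_pref M m (n - 1 - j) w"]])
      show "vars s' ''n'' = n" using s' Pn by blast
      show "bfits B s2 (MenPref (V ''m'') (mirror_exp True (V ''c'')) (V ''w'')) \<and>
        (bval M s2 (MenPref (V ''m'') (mirror_exp True (V ''c'')) (V ''w'')) \<longleftrightarrow>
          men_pref M m (n - 1 - vars s2 ''c'') w)"
        if "same_except {''a'', ''b'', ''c''} s' s2" "vars s2 ''c'' < n" for s2
      proof -
        have "vars s2 ''n'' = n" "vars s2 ''w'' = w" "vars s2 ''m'' = m"
          using that(1) s' Pn[of s'] by (simp_all add: P_def same_except_def)
        then show ?thesis
          using that(2) Bn m w by (simp add: aval_mirror_exp afits_mirror_exp) (simp add: mirror_def)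
      qed
      show "men_pref M m (n - 1 - i) w"
        if "n - 1 - w < i" "i < j" "j < n" "men_pref M m (n - 1 - j) w" for i j
        using men_between[of m "n - 1 - w" i j True] that m w by (simp add: mirror_def)
    qed (use s' w B in \<open>auto simp: P_def L_def same_except_def mirror_exp_def\<close>)
  next
    fix s' assume s': "P s' \<and> H (vars s' ''hi'') \<and> L (vars s' ''b'')"
    then show "runs M B (Assign ''lo'' (Sub (V ''n'') (V ''b''))) s' 6
      (\<lambda>s'. P s' \<and> H (vars s' ''hi'') \<and> (\<exists>b. L b \<and> vars s' ''lo'' = n - b))"
      using Pn[of s'] Bn by (intro runs_straight) (auto simp: P_def same_except_def L_def)
  qed
  then show ?thesis
  proof (rule runs_weaken)
    fix s' assume s': "P s' \<and> H (vars s' ''hi'') \<and> (\<exists>b. L b \<and> vars s' ''lo'' = n - b)"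
    then obtain b where b: "L b" "vars s' ''lo'' = n - b" by blast
    \<comment> \<open>The reflected search ends at an exclusive upper end \<open>b\<close>; its last
      member \<open>b - 1\<close> reflects to \<open>n - 1 - (b - 1) = n - b\<close>, an inclusive
      lower end.\<close>
    have "n - b \<le> u \<and> u < vars s' ''hi'' \<longleftrightarrow> men_pref M m u w" if u: "u < n" "u \<noteq> w" for u
    proof (cases "u < w")
      case True
      then have "n - 1 - w < n - 1 - u" "n - 1 - u < n" using w by linarith+
      then have "men_pref M m (n - 1 - (n - 1 - u)) w \<longleftrightarrow> n - 1 - u < b"
        using b(1) unfolding L_def by blast
      moreover have "n - 1 - u < b \<longleftrightarrow> n - b \<le> u"
        using b(1) u unfolding L_def by linarith
      ultimately show ?thesis
        using s' True u by (simp add: H_def)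
    next
      case False
      moreover have "n - b \<le> w" using b(1) w unfolding L_def by linarith
      ultimately show ?thesis
        using s' u by (auto simp: H_def)
    qed
    with s' b show "same_except ?X s s' \<and> arrs s' = arrs s \<and>
      vars s' ''m'' = mirror n d i \<and> vars s' ''w'' = \<mu> (mirror n d i) \<and>
      vars s' ''lo'' \<le> n \<and> vars s' ''hi'' \<le> n \<and>
      (\<forall>u<n. u \<noteq> \<mu> (mirror n d i) \<longrightarrow>
        (vars s' ''lo'' \<le> u \<and> u < vars s' ''hi'' \<longleftrightarrow>
         men_pref M (mirror n d i) u (\<mu> (mirror n d i))))"
      unfolding m_def[symmetric] w_def[symmetric] by (auto simp: P_def H_def)
  qed simp
qed

text \<open>
  The endpoints \<open>v\<close> only have to be correct from position \<open>i\<close> on, where the remaining queries are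
  made; for a woman who has not been inserted this means \<open>v u \<le> i\<close>.
\<close>

definition inserted :: "bool \<Rightarrow> nat \<Rightarrow> (nat \<Rightarrow> nat) \<Rightarrow> bool" where
  "inserted d i v \<longleftrightarrow> (\<forall>u<n. v u \<le> n) \<and>
     (\<forall>u<n. \<forall>x. i \<le> x \<longrightarrow> x < n \<longrightarrow>
        (x < v u \<longleftrightarrow> (\<exists>y<i. u = \<mu> (mirror n d y) \<and> women_pref M u (mirror n d x) (mirror n d y))))"

text \<open>By injectivity of the matching, the wife of man \<open>i\<close> belongs to no earlier
  man, so her old value is at most \<open>i\<close>. From position \<open>i + 1\<close> on, the
  maximum with \<open>y\<close> therefore behaves like \<open>y\<close> itself.\<close>

lemma inserted_step:
  assumes v: "inserted d i v" and i: "i < n" and y: "y \<le> n"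
    and last: "\<And>x. i < x \<Longrightarrow> x < n \<Longrightarrow>
      women_pref M (\<mu> (mirror n d i)) (mirror n d x) (mirror n d i) \<longleftrightarrow> x < y"
  shows "inserted d (Suc i) (v(\<mu> (mirror n d i) := max (v (\<mu> (mirror n d i))) y))"
proof -
  let ?w = "\<mu> (mirror n d i)"
  have w: "?w < n" using i by (simp add: matching_less mirror_less)
  have new: "?w \<noteq> \<mu> (mirror n d z)" if "z < i" for z
    using that i matching_inj[of "mirror n d i" "mirror n d z"] mirror_inj[of i n z d]
      mirror_less[of _ n d] by auto
  have "x < (v(?w := max (v ?w) y)) u \<longleftrightarrow>
    (\<exists>z<Suc i. u = \<mu> (mirror n d z) \<and> women_pref M u (mirror n d x) (mirror n d z))"
    if u: "u < n" and x: "Suc i \<le> x" "x < n" for u x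
  proof -
    have old: "x < v u \<longleftrightarrow>
      (\<exists>z<i. u = \<mu> (mirror n d z) \<and> women_pref M u (mirror n d x) (mirror n d z))"
      using v u x by (simp add: inserted_def)
    show ?thesis
      using old new last[of x] x by (cases "u = ?w") (auto simp: less_Suc_eq)
  qed
  with v w y show ?thesis by (simp add: inserted_def)
qed

text \<open>The parameter \<open>res\<close> is the verdict present when the sweep starts; the
  second sweep has to preserve a 0 found by the first.\<close>

definition sweep_inv :: "bool \<Rightarrow> string \<Rightarrow> nat \<Rightarrow> nat \<Rightarrow> state \<Rightarrow> bool" where
  "sweep_inv d r res i s \<longleftrightarrow> input_ok s \<and> i \<le> n \<and> vars s ''i'' = i \<and>
     vars s ''result'' = (if \<exists>x<i. \<exists>y<x. blocks d x y then 0 else res) \<and>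
     (\<exists>v. inserted d i v \<and> tree_rep n (arrs s r) v)"

text \<open>The query precedes the insertion, so it sees the wives of strictly earlier men only. For
  the wife a single search upward from her own husband is enough, because all remaining queries come
  from positions after his.\<close>

lemma runs_sweep_body:
  assumes s: "sweep_inv d r res i s" and i: "i < n" and r: "r \<noteq> ''mu''"
  shows "runs M B (sweep_body d r) s (230 * lev n + 130)
    (\<lambda>s'. sweep_inv d r res (Suc i) s' \<and> (\<forall>a. a \<noteq> r \<longrightarrow> arrs s' a = arrs s a))"
proof -
  obtain v where v: "inserted d i v" "tree_rep n (arrs s r) v"
    using s by (auto simp: sweep_inv_def)
  have vn: "v u \<le> n" if "u < n" for u using v that by (simp add: inserted_def)
  have si: "input_ok s" "vars s ''i'' = i" "vars s ''n'' = n"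
    using s by (auto simp: sweep_inv_def input_ok_def)
  define m where "m = mirror n d i"
  define w where "w = \<mu> m"
  have m: "m < n" using i by (simp add: m_def mirror_less)
  then have w: "w < n" by (simp add: w_def matching_less)
  define res1 where "res1 = (if \<exists>x<i. \<exists>y<x. blocks d x y then 0 else res)"
  define res2 where "res2 = (if \<exists>x<Suc i. \<exists>y<x. blocks d x y then 0 else res)"
  define P where "P = (\<lambda>s' :: state. vars s' ''n'' = n \<and> vars s' ''i'' = i \<and> vars s' ''m'' = m \<and>
    vars s' ''w'' = w \<and> arrs s' = arrs s)"
  define L where "L = (\<lambda>lo hi. lo \<le> n \<and> hi \<le> n \<and>
    (\<forall>u<n. u \<noteq> w \<longrightarrow> (lo \<le> u \<and> u < hi \<longleftrightarrow> men_pref M m u w)))"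
  define W where "W = (\<lambda>b. b \<le> n \<and>
    (\<forall>x. i < x \<longrightarrow> x < n \<longrightarrow> (women_pref M w (mirror n d x) m \<longleftrightarrow> x < b)))"
  have "runs M B (sweep_body d r) s
     ((80 * lev n + 60) + ((60 * lev n + 20) + (2 + ((40 * lev n + 10) + ((50 * lev n + 20) + 4)))))
    (\<lambda>s'. sweep_inv d r res (Suc i) s' \<and> (\<forall>a. a \<noteq> r \<longrightarrow> arrs s' a = arrs s a))"
    unfolding sweep_body_def
  proof (intro runs_Seq)
    show "runs M B (men_range d) s (80 * lev n + 60)
      (\<lambda>s'. P s' \<and> vars s' ''result'' = res1 \<and> L (vars s' ''lo'') (vars s' ''hi''))"
      using s si
      by (intro runs_weaken[OF runs_men_range[OF si(1,2) i, of d]])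
        (auto simp: P_def L_def same_except_def sweep_inv_def res1_def simp flip: m_def w_def)
  next
    fix s' assume s': "P s' \<and> vars s' ''result'' = res1 \<and> L (vars s' ''lo'') (vars s' ''hi'')"
    \<comment> \<open>The threshold \<open>i < v u\<close> says that \<open>u\<close> is the wife of
      an earlier man and prefers \<open>m\<close> to him; the range supplies the preference of
      \<open>m\<close>. Since \<open>L\<close> is silent about the own wife \<open>w\<close>,
      \<open>new\<close> is used to rule her out.\<close>
    have "(\<exists>u<n. vars s' ''lo'' \<le> u \<and> u < vars s' ''hi'' \<and> i < v u) \<longleftrightarrow> (\<exists>y<i. blocks d i y)"
    proof -
      have iv: "i < v u \<longleftrightarrow> (\<exists>y<i. u = \<mu> (mirror n d y) \<and> women_pref M u m (mirror n d y))"
        if "u < n" for u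
        using v(1) that i by (simp add: inserted_def m_def)
      have new: "\<mu> (mirror n d y) \<noteq> w" "\<mu> (mirror n d y) < n" if "y < i" for y
        using that i m matching_inj[of m "mirror n d y"] mirror_inj[of i n y d]
          mirror_less[of _ n d] by (auto simp: w_def m_def matching_less)
      have "(\<exists>u<n. vars s' ''lo'' \<le> u \<and> u < vars s' ''hi'' \<and> i < v u) \<longleftrightarrow>
        (\<exists>u<n. vars s' ''lo'' \<le> u \<and> u < vars s' ''hi'' \<and>
           (\<exists>y<i. u = \<mu> (mirror n d y) \<and> women_pref M u m (mirror n d y)))"
        using iv by blast
      also have "\<dots> \<longleftrightarrow> (\<exists>y<i. men_pref M m (\<mu> (mirror n d y)) w \<and>
           women_pref M (\<mu> (mirror n d y)) m (mirror n d y))"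
        using s' new unfolding L_def by metis
      finally show ?thesis by (simp add: blocks_def m_def w_def)
    qed
    then have res2: "(if \<exists>u<n. vars s' ''lo'' \<le> u \<and> u < vars s' ''hi'' \<and> i < v u then 0 else res1) = res2"
      by (auto simp: less_Suc_eq res1_def res2_def)
    have vs: "vars s' ''n'' = n" "vars s' ''i'' = i" "vars s' ''lo'' \<le> n" "vars s' ''hi'' \<le> n"
      "vars s' ''result'' = res1" "tree_rep n (arrs s' r) v"
      using s' v by (simp_all add: P_def L_def)
    show "runs M B (tree_query r) s' (60 * lev n + 20) (\<lambda>s'. P s' \<and> vars s' ''result'' = res2)"
    proof (rule runs_weaken[OF runs_tree_query[OF vs(1,2) less_imp_le[OF i] refl vs(3)
            refl vs(4) B vs(6) vn]])
      fix s2
      assume "same_except {''lo'', ''hi'', ''base'', ''result''} s' s2 \<and> arrs s2 = arrs s' \<and>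
        vars s2 ''result'' = (if \<exists>u<n. vars s' ''lo'' \<le> u \<and> u < vars s' ''hi'' \<and> i < v u
          then 0 else vars s' ''result'')"
      then show "P s2 \<and> vars s2 ''result'' = res2"
        using s' unfolding vs(5) res2 by (simp add: P_def same_except_def)
    qed simp_all
  next
    fix s' assume "P s' \<and> vars s' ''result'' = res2"
    then show "runs M B (Assign ''a'' (V ''i'')) s' 2
      (\<lambda>s'. P s' \<and> vars s' ''result'' = res2 \<and> vars s' ''a'' = i)"
      using Bn i by (intro runs_straight) (auto simp: P_def)
  next
    fix s' assume s': "P s' \<and> vars s' ''result'' = res2 \<and> vars s' ''a'' = i"
    let ?t = "WomenPref (V ''w'') (mirror_exp d (V ''c'')) (V ''m'')"
    show "runs M B (bisect ?t) s' (40 * lev n + 10)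
      (\<lambda>s'. P s' \<and> vars s' ''result'' = res2 \<and> W (vars s' ''b''))"
    proof (rule runs_weaken[OF runs_bisect[where k = i and n = n and
            P = "\<lambda>x. women_pref M w (mirror n d x) m"]])
      show "bfits B s2 ?t \<and> (bval M s2 ?t \<longleftrightarrow> women_pref M w (mirror n d (vars s2 ''c'')) m)"
        if "same_except {''a'', ''b'', ''c''} s' s2" "vars s2 ''c'' < n" for s2
      proof -
        have "vars s2 ''n'' = n" "vars s2 ''w'' = w" "vars s2 ''m'' = m"
          using that(1) s' by (simp_all add: P_def same_except_def)
        then show ?thesis
          using that(2) Bn m w by (simp add: aval_mirror_exp afits_mirror_exp)
      qed
      show "women_pref M w (mirror n d x) m"
        if "i < x" "x < j" "j < n" "women_pref M w (mirror n d j) m" for x j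
        using women_between[of w i x j d] that w by (simp add: m_def)
    qed (use s' i B acost_mirror_exp[of d "V ''c''"] in \<open>auto simp: P_def W_def same_except_def\<close>)
  next
    fix s' assume s': "P s' \<and> vars s' ''result'' = res2 \<and> W (vars s' ''b'')"
    define y where "y = vars s' ''b''"
    have ins: "inserted d (Suc i) (v(w := max (v w) y))"
      using inserted_step[OF v(1) i, of y] s' by (simp add: W_def y_def m_def w_def)
    show "runs M B (tree_insert r) s' (50 * lev n + 20)
      (\<lambda>s'. vars s' ''n'' = n \<and> vars s' ''i'' = i \<and> vars s' ''result'' = res2 \<and>
         (\<forall>a. a \<noteq> r \<longrightarrow> arrs s' a = arrs s a) \<and>
         (\<exists>v. inserted d (Suc i) v \<and> tree_rep n (arrs s' r) v))"
    proof (intro runs_weaken[OF runs_tree_insert[where w = w and y = y, OF _ _ w _ _ B _ vn]])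
      fix s2
      assume "same_except {''k'', ''base'', ''c''} s' s2 \<and> (\<forall>a. a \<noteq> r \<longrightarrow> arrs s2 a = arrs s' a) \<and>
        tree_rep n (arrs s2 r) (v(w := max (v w) y))"
      with ins s' show "vars s2 ''n'' = n \<and> vars s2 ''i'' = i \<and> vars s2 ''result'' = res2 \<and>
         (\<forall>a. a \<noteq> r \<longrightarrow> arrs s2 a = arrs s a) \<and>
         (\<exists>v. inserted d (Suc i) v \<and> tree_rep n (arrs s2 r) v)"
        by (auto simp: P_def same_except_def simp del: fun_upd_apply)
    qed (use s' v in \<open>simp_all add: P_def W_def y_def\<close>)
  next
    fix s' :: state assume s': "vars s' ''n'' = n \<and> vars s' ''i'' = i \<and> vars s' ''result'' = res2 \<and>
         (\<forall>a. a \<noteq> r \<longrightarrow> arrs s' a = arrs s a) \<and>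
         (\<exists>v. inserted d (Suc i) v \<and> tree_rep n (arrs s' r) v)"
    then show "runs M B (Assign ''i'' (Add (V ''i'') (N 1))) s' 4
      (\<lambda>s'. sweep_inv d r res (Suc i) s' \<and> (\<forall>a. a \<noteq> r \<longrightarrow> arrs s' a = arrs s a))"
      using si i r Bn by (intro runs_straight) (simp_all add: sweep_inv_def input_ok_def res2_def)
  qed
  then show ?thesis by (rule runs_weaken) simp_all
qed

lemma runs_sweep:
  assumes s: "input_ok s" "arrs s r = (\<lambda>_. 0)" and r: "r \<noteq> ''mu''"
  shows "runs M B (sweep d r) s (n * (230 * lev n + 140) + 10)
    (\<lambda>s'. input_ok s' \<and> (\<forall>a. a \<noteq> r \<longrightarrow> arrs s' a = arrs s a) \<and>
      vars s' ''result'' = (if \<exists>x<n. \<exists>y<x. blocks d x y then 0 else vars s ''result''))"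
proof -
  let ?b = "Less (V ''i'') (V ''n'')"
  define I where "I = (\<lambda>i s'. sweep_inv d r (vars s ''result'') i s' \<and>
    (\<forall>a. a \<noteq> r \<longrightarrow> arrs s' a = arrs s a))"
  have vs: "vars s' ''n'' = n" "vars s' ''i'' = i" "i \<le> n" if "I i s'" for i s'
    using that by (auto simp: I_def sweep_inv_def input_ok_def)
  show ?thesis
    unfolding sweep_def
  proof (rule runs_weaken[OF runs_Seq[where T = 2 and
          U = "n * (1 + bcost ?b + (230 * lev n + 130)) + 1 + bcost ?b" and P = "I 0"]])
    \<comment> \<open>A zero array is the empty tree. This is why the two sweeps use different
      arrays instead of clearing one.\<close>
    have "inserted d 0 (\<lambda>_. 0)" "tree_rep n (\<lambda>_. 0) (\<lambda>_. 0)"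
      by (auto simp: inserted_def tree_rep_def level_rep_def)
    then show "runs M B (Assign ''i'' (N 0)) s 2 (I 0)"
      using s Bn by (intro runs_straight) (auto simp: I_def sweep_inv_def input_ok_def)
    show "runs M B (While ?b (sweep_body d r)) s'
            (n * (1 + bcost ?b + (230 * lev n + 130)) + 1 + bcost ?b) (I n)" if "I 0 s'" for s'
    proof (rule runs_While[where I = I])
      show "bfits B s1 ?b" if "I i s1" for i s1
        using vs[OF that] Bn by simp
      show "i < n \<and> runs M B (sweep_body d r) s1 (230 * lev n + 130) (I (Suc i))"
        if "I i s1" "bval M s1 ?b" for i s1
      proof
        show "i < n" using that vs[OF that(1)] by simp
        then show "runs M B (sweep_body d r) s1 (230 * lev n + 130) (I (Suc i))"
          using that(1) r by (intro runs_weaken[OF runs_sweep_body]) (auto simp: I_def)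
      qed
      show "I n s1" if "I i s1" "\<not> bval M s1 ?b" for i s1
        using that vs[OF that(1)] by simp
    qed (use that in auto)
  qed (auto simp: I_def sweep_inv_def algebra_simps)
qed

text \<open>The woman of an unmatched pair has a husband other than the man, who comes either before
  or after him. The former case is seen in the original order and the latter in the reflected
  one.\<close>

lemma stable_iff_no_blocks:
  "stable_matching M \<mu> \<longleftrightarrow> \<not> (\<exists>d. \<exists>x<n. \<exists>y<x. blocks d x y)"
proof -
  have bij: "bij_betw \<mu> {..<n} {..<n}"
    using matching n by (simp add: perfect_matching_def)
  have husband: "husband M \<mu> (\<mu> y) = y" if "y < n" for y
    using bij that n by (simp add: husband_def bij_betw_def the_inv_into_f_f)
  show ?thesis
  proof
    assume st: "stable_matching M \<mu>"
    show "\<not> (\<exists>d. \<exists>x<n. \<exists>y<x. blocks d x y)"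
    proof
      assume "\<exists>d. \<exists>x<n. \<exists>y<x. blocks d x y"
      then obtain d x y where xy: "x < n" "y < x" "blocks d x y" by blast
      define m where "m = mirror n d x"
      define h where "h = mirror n d y"
      have mh: "m < n" "h < n" "m \<noteq> h"
        using xy mirror_inj[of x n y d] by (auto simp: m_def h_def mirror_less)
      then have "\<mu> h < n" "\<mu> m \<noteq> \<mu> h"
        using matching_inj by (auto simp: matching_less)
      with xy mh st show False
        unfolding stable_matching_def n blocks_def m_def[symmetric] h_def[symmetric]
        using husband[of h] by metis
    qed
  next
    assume no: "\<not> (\<exists>d. \<exists>x<n. \<exists>y<x. blocks d x y)"
    have False if mw: "m < n" "w < n" "\<mu> m \<noteq> w" "men_pref M m w (\<mu> m)"
      "women_pref M w m (husband M \<mu> w)" for m w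
    proof -
      obtain h where h: "h < n" "\<mu> h = w"
        using bij mw(2) unfolding bij_betw_def by (metis imageE lessThan_iff)
      have pref: "women_pref M w m h" using mw(5) husband[OF h(1)] h(2) by simp
      have "m \<noteq> h" using mw h by auto
      then consider "h < m" | "m < h" by linarith
      then show False
      proof cases
        case 1
        then have "blocks False m h" using mw pref h by (simp add: blocks_def mirror_def)
        with no 1 mw show False by blast
      next
        case 2
        have "blocks True (n - 1 - m) (n - 1 - h)"
          using mw pref h by (simp add: blocks_def mirror_def)
        moreover have "n - 1 - h < n - 1 - m" "n - 1 - m < n" using 2 h by auto
        ultimately show False using no by blast
      qed
    qed
    then show "stable_matching M \<mu>" unfolding stable_matching_def n by blast
  qed
qed

lemma runs_checker:
  "runs M B checker (input_state M \<mu>) (2 * (n * (230 * lev n + 140)) + 30)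
     (\<lambda>s. vars s ''result'' = (if stable_matching M \<mu> then 1 else 0))"
proof -
  let ?up = "\<exists>x<n. \<exists>y<x. blocks False x y"
  let ?down = "\<exists>x<n. \<exists>y<x. blocks True x y"
  have stable: "stable_matching M \<mu> \<longleftrightarrow> \<not> ?up \<and> \<not> ?down"
    unfolding stable_iff_no_blocks by (metis (full_types))
  have "runs M B checker (input_state M \<mu>)
     (2 + ((n * (230 * lev n + 140) + 10) + (n * (230 * lev n + 140) + 10)))
     (\<lambda>s. vars s ''result'' = (if stable_matching M \<mu> then 1 else 0))"
    unfolding checker_def
  proof (intro runs_Seq)
    show "runs M B (Assign ''result'' (N 1)) (input_state M \<mu>) 2
      (\<lambda>s. input_ok s \<and> arrs s ''up'' = (\<lambda>_. 0) \<and> arrs s ''down'' = (\<lambda>_. 0) \<and> vars s ''result'' = 1)"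
      using Bn n by (intro runs_straight) (auto simp: input_ok_def input_state_def)
  next
    fix s assume s: "input_ok s \<and> arrs s ''up'' = (\<lambda>_. 0) \<and> arrs s ''down'' = (\<lambda>_. 0) \<and>
      vars s ''result'' = 1"
    then show "runs M B (sweep False ''up'') s (n * (230 * lev n + 140) + 10)
      (\<lambda>s. input_ok s \<and> arrs s ''down'' = (\<lambda>_. 0) \<and> vars s ''result'' = (if ?up then 0 else 1))"
      by (intro runs_weaken[OF runs_sweep]) auto
  next
    fix s assume s: "input_ok s \<and> arrs s ''down'' = (\<lambda>_. 0) \<and> vars s ''result'' = (if ?up then 0 else 1)"
    then show "runs M B (sweep True ''down'') s (n * (230 * lev n + 140) + 10)
      (\<lambda>s. vars s ''result'' = (if stable_matching M \<mu> then 1 else 0))"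
      by (intro runs_weaken[OF runs_sweep]) (auto simp: stable)
  qed
  then show ?thesis by (rule runs_weaken) simp_all
qed

end

subsection \<open>Asymptotics\<close>

text \<open>Taking logarithms in \<open>2 ^ lev n \<le> 2 * n\<close> gives
  \<open>lev n * ln 2 \<le> ln 2 + ln n\<close>; for \<open>n \<ge> 2\<close> the extra
  \<open>ln 2\<close> is absorbed by a second \<open>ln n\<close>.\<close>

lemma lev_le_ln:
  assumes "2 \<le> n"
  shows "real (lev n) \<le> 2 / ln 2 * ln (real n)"
proof -
  have "real (2 ^ lev n) \<le> real (2 * n)"
    using power_lev_le[of n] assms by (subst of_nat_le_iff) simp
  then have "(2 :: real) ^ lev n \<le> 2 * real n" by simp
  then have "ln ((2 :: real) ^ lev n) \<le> ln (2 * real n)"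
    using assms by (subst ln_le_cancel_iff) auto
  then have "real (lev n) * ln 2 \<le> ln 2 + ln (real n)"
    using assms by (simp add: ln_realpow ln_mult)
  moreover have "ln 2 \<le> ln (real n)" using assms by simp
  ultimately show ?thesis by (simp add: field_simps)
qed

lemma lev_ge_1: "2 \<le> n \<Longrightarrow> 1 \<le> lev n"
  by (simp add: lev_pos)

theorem theorem11:
  "\<exists>(prog :: com) (w :: nat \<Rightarrow> nat) (T :: nat \<Rightarrow> nat).
     (\<lambda>n. real (w n)) \<in> O(\<lambda>n. ln (real n)) \<and>
     (\<lambda>n. real (T n)) \<in> O(\<lambda>n. real n * ln (real n)) \<and>
     (\<forall>M \<mu>. single_peaked_market M \<longrightarrow> perfect_matching M \<mu> \<longrightarrow>
        (\<exists>t s. exec M (2 ^ w (num M)) prog (input_state M \<mu>) t s \<and>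
               t \<le> T (num M) \<and>
               vars s ''result'' = (if stable_matching M \<mu> then 1 else 0)))"
proof -
  \<comment> \<open>Chosen so that \<open>2 ^ w n = (4 * 2 ^ lev n)^2\<close>, which dominates
    \<open>(n + 2)^2\<close> because \<open>n < 2 ^ lev n\<close>.\<close>
  define w where "w = (\<lambda>n. 2 * lev n + 4)"
  define T where "T = (\<lambda>n. 2 * (n * (230 * lev n + 140)) + 30)"
  have w: "w n \<le> 6 * lev n" if "2 \<le> n" for n
    using lev_ge_1[OF that] by (simp add: w_def)
  \<comment> \<open>For \<open>n \<ge> 2\<close> both \<open>n\<close> and 1 are at most
    \<open>n * lev n\<close>, so the coefficients 460, 280 and 30 may be added; 800 is their sum
    rounded up.\<close>
  have T: "T n \<le> 800 * (n * lev n)" if "2 \<le> n" for n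
  proof -
    have "n \<le> n * lev n" "1 \<le> n * lev n" using lev_ge_1[OF that] that by auto
    moreover have "T n = 460 * (n * lev n) + 280 * n + 30"
      by (simp add: T_def algebra_simps)
    ultimately show ?thesis by linarith
  qed
  have "(\<lambda>n. real (w n)) \<in> O(\<lambda>n. ln (real n))"
  proof (rule bigoI)
    \<comment> \<open>The comparison starts at 2, since \<open>ln\<close> vanishes at 1 while
      \<open>w\<close> is positive there. The constant is 6 from \<open>w\<close> times
      \<open>2 / ln 2\<close> from \<open>lev_le_ln\<close>.\<close>
    show "\<forall>\<^sub>F n in at_top. norm (real (w n)) \<le> 12 / ln 2 * norm (ln (real n))"
      using eventually_ge_at_top[of "2 :: nat"]
    proof eventually_elim
      case (elim n)
      have "real (w n) \<le> 6 * real (lev n)" using w[OF elim] by linarith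
      also have "\<dots> \<le> 6 * (2 / ln 2 * ln (real n))" using lev_le_ln[OF elim] by simp
      finally show ?case using elim by simp
    qed
  qed
  moreover have "(\<lambda>n. real (T n)) \<in> O(\<lambda>n. real n * ln (real n))"
  proof (rule bigoI)
    show "\<forall>\<^sub>F n in at_top. norm (real (T n)) \<le> 1600 / ln 2 * norm (real n * ln (real n))"
      using eventually_ge_at_top[of "2 :: nat"]
    proof eventually_elim
      case (elim n)
      have "real (T n) \<le> real (800 * (n * lev n))" using T[OF elim] by (simp only: of_nat_le_iff)
      also have "\<dots> = 800 * (real n * real (lev n))" by simp
      also have "\<dots> \<le> 800 * (real n * (2 / ln 2 * ln (real n)))"
        using lev_le_ln[OF elim] by (intro mult_left_mono) auto
      finally show ?case using elim by (simp add: abs_mult mult_ac)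
    qed
  qed
  moreover have "\<exists>t s. exec M (2 ^ w (num M)) checker (input_state M \<mu>) t s \<and>
      t \<le> T (num M) \<and> vars s ''result'' = (if stable_matching M \<mu> then 1 else 0)"
    if "single_peaked_market M" "perfect_matching M \<mu>" for M \<mu>
  proof -
    have "num M + 2 \<le> 4 * 2 ^ lev (num M)" using less_power_lev[of "num M"] by linarith
    then have "(num M + 2)\<^sup>2 \<le> (4 * 2 ^ lev (num M))\<^sup>2" by (rule power_mono) simp
    also have "\<dots> = 2 ^ w (num M)"
      by (simp add: w_def power_mult_distrib power_add power_even_eq)
    finally interpret matched_market M \<mu> "num M" "2 ^ w (num M)"
      using that by unfold_locales simp_all
    show ?thesis using runs_checker unfolding runs_def T_def .
  qed
  ultimately show ?thesis by blast
qed

end
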